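(* Let $0<q<1$, let $k\ge 1$ be an integer, and let $f(x_1,y_1,\ldots,x_k,y_k)$ be a $2k$-variable complex function that is analytic at $(0,0,\ldots,0)\in\mathbb{C}^{2k}$. Then: (i) $f$ can be expanded in terms of $h_{n_1}(x_1,y_1|q)\cdots h_{n_k}(x_k,y_k|q)$ if and only if $f$ satisfies the $q$-partial differential equations $\partial_{q,x_j}\{f\}=\partial_{q,y_j}\{f\}$ for $j=1,2,\ldots,k$. (ii) $f$ can be expanded in terms of $g_{n_1}(x_1,y_1|q)\cdots g_{n_k}(x_k,y_k|q)$ if and only if $f$ satisfies the $q$-partial differential equations $\partial_{q^{-1},x_j}\{f\}=\partial_{q^{-1},y_j}\{f\}$ for $j=1,2,\ldots,k$.
   Context: For $0<q<1$: $(a;q)_0=1$, $(a;q)_n=\prod_{i=0}^{n-1}(1-aq^i)$. The $q$-binomial coefficient is ${n\brack k}_q=\frac{(q;q)_n}{(q;q)_k(q;q)_{n-k}}$. The Rogers-Szegő polynomials are $h_n(x,y|q)=\sum_{k=0}^n{n\brack k}_q x^ky^{n-k}$ and the Stieltjes-Wigert polynomials are $g_n(x,y|q)=h_n(x,y|q^{-1})=\sum_{k=0}^n{n\brack k}_q q^{k(k-n)}x^ky^{n-k}$. For $p\in\{q,q^{-1}\}$ the $p$-derivative of a function of one variable is $\mathcal{D}_{p,x}\{f(x)\}=\frac{f(x)-f(px)}{x}$ (for analytic $f$, extended to $x=0$ by continuity). The $p$-partial derivative $\partial_{p,x}\{f\}$ of a function of several variables is its $p$-derivative with respect to $x$, regarding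 the other variables as constants. The $q$-partial differential equations are understood to hold in a neighbourhood of the origin. "$f$ can be expanded in terms of $\phi_{n_1,\ldots,n_k}$" means that there are complex coefficients $\alpha_{n_1,\ldots,n_k}$, independent of the variables $x_1,y_1,\ldots,x_k,y_k$, such that $f=\sum_{n_1,\ldots,n_k=0}^\infty\alpha_{n_1,\ldots,n_k}\phi_{n_1,\ldots,n_k}$, the series converging absolutely to $f$ in a neighbourhood of the origin. *)

theory Defs
  imports "HOL-Analysis.Analysis"
begin

definition q_pochhammer :: "real \<Rightarrow> real \<Rightarrow> nat \<Rightarrow> real" where
  "q_pochhammer a q n = (\<Prod>i<n. 1 - a * q ^ i)"

definition q_binomial :: "real \<Rightarrow> nat \<Rightarrow> nat \<Rightarrow> real" where
  "q_binomial q n k = q_pochhammer q q n / (q_pochhammer q q k * q_pochhammer q q (n - k))"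

definition rogers_szego :: "real \<Rightarrow> nat \<Rightarrow> complex \<Rightarrow> complex \<Rightarrow> complex" where
  "rogers_szego q n x y = (\<Sum>k\<le>n. of_real (q_binomial q n k) * x ^ k * y ^ (n - k))"

text \<open>The exponent \<open>k(k - n)\<close> is a nonpositive integer, hence \<open>powi\<close>.\<close>

definition stieltjes_wigert :: "real \<Rightarrow> nat \<Rightarrow> complex \<Rightarrow> complex \<Rightarrow> complex" where
  "stieltjes_wigert q n x y =
     (\<Sum>k\<le>n. of_real (q_binomial q n k * q powi (int k * (int k - int n))) * x ^ k * y ^ (n - k))"

lemma q_pochhammer_inverse:
  assumes "q \<noteq> (0::real)"
  shows "q_pochhammer (inverse q) (inverse q) n =
           (\<Prod>i<n. - (inverse q ^ Suc i)) * q_pochhammer q q n"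
  unfolding q_pochhammer_def prod.distrib [symmetric]
  by (rule prod.cong) (use assms in \<open>auto simp: field_simps\<close>)

lemma prod_neg_inverse_power_add:
  "(\<Prod>i<k + m. - (inverse (q::real) ^ Suc i)) =
     (\<Prod>i<k. - (inverse q ^ Suc i)) * (\<Prod>i<m. - (inverse q ^ Suc i)) * inverse q ^ (k * m)"
  by (induction m) (simp_all add: power_add algebra_simps)

lemma q_binomial_inverse:
  assumes "q \<noteq> 0" and "k \<le> n"
  shows "q_binomial (inverse q) n k = q_binomial q n k * q powi (int k * (int k - int n))"
proof -
  obtain m where n: "n = k + m"
    using assms(2) by (auto simp: le_iff_add)
  have "int k * (int k - int n) = - int (k * m)"
    by (simp add: n algebra_simps)
  then have powi: "q powi (int k * (int k - int n)) = inverse q ^ (k * m)"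
    by (simp only: power_int_minus power_int_of_nat power_inverse)
  have nz: "(\<Prod>i<l. - (inverse q ^ Suc i)) \<noteq> 0" for l
    using assms(1) by simp
  show ?thesis
    unfolding q_binomial_def q_pochhammer_inverse [OF assms(1)] powi
    unfolding n prod_neg_inverse_power_add add_diff_cancel_left'
    using nz [of k] nz [of m] assms(1) by simp
qed

text \<open>The two descriptions of the Stieltjes-Wigert polynomials agree.\<close>

lemma stieltjes_wigert_conv_rogers_szego:
  assumes "q \<noteq> 0"
  shows "stieltjes_wigert q n x y = rogers_szego (inverse q) n x y"
  unfolding stieltjes_wigert_def rogers_szego_def
  by (rule sum.cong) (simp_all add: q_binomial_inverse [OF assms])

text \<open>The value at \<open>0\<close> is the extension by continuity; \<open>Lim\<close> is meaningful only where that
  limit exists, which is the case whenever \<open>f\<close> is differentiable at \<open>0\<close>.\<close>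

definition p_deriv :: "real \<Rightarrow> (complex \<Rightarrow> complex) \<Rightarrow> complex \<Rightarrow> complex" where
  "p_deriv p f x =
     (if x = 0 then Lim (at 0) (\<lambda>t. (f t - f (of_real p * t)) / t)
      else (f x - f (of_real p * x)) / x)"

definition p_partial :: "real \<Rightarrow> 'n \<Rightarrow> (complex ^ 'n \<Rightarrow> complex) \<Rightarrow> complex ^ 'n \<Rightarrow> complex" where
  "p_partial p i f z = p_deriv p (\<lambda>t. f (\<chi> l. if l = i then t else z $ l)) (z $ i)"

text \<open>Analyticity in several complex variables: \<open>f\<close> is the sum of a multiple power series
  in a neighbourhood of \<open>a\<close>. Multi-indices are functions \<open>m :: 'n \<Rightarrow> nat\<close>; \<open>has_sum\<close> is
  unconditional, hence for complex terms absolute, summation.\<close>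

definition analytic_at_point :: "(complex ^ 'n::finite \<Rightarrow> complex) \<Rightarrow> complex ^ 'n \<Rightarrow> bool" where
  "analytic_at_point f a \<longleftrightarrow>
     (\<exists>c :: ('n \<Rightarrow> nat) \<Rightarrow> complex. \<forall>\<^sub>F z in nhds a.
        ((\<lambda>m. c m * (\<Prod>i\<in>UNIV. (z $ i - a $ i) ^ m i)) has_sum f z) UNIV)"

definition expandable_in ::
  "(complex ^ 'n::finite \<Rightarrow> complex) \<Rightarrow> ('i \<Rightarrow> complex ^ 'n \<Rightarrow> complex) \<Rightarrow> bool" where
  "expandable_in f \<phi> \<longleftrightarrow>
     (\<exists>\<alpha> :: 'i \<Rightarrow> complex. \<forall>\<^sub>F z in nhds 0.
        (\<lambda>n. norm (\<alpha> n * \<phi> n z)) summable_on UNIV \<and>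
        ((\<lambda>n. \<alpha> n * \<phi> n z) has_sum f z) UNIV)"

text \<open>A point of \<open>\<complex>\<^sup>2\<^sup>k\<close> is a vector \<open>z :: complex ^ ('k + 'k)\<close> where \<open>CARD('k)\<close> is \<open>k\<close>,
  with \<open>x\<^sub>j = z $ Inl j\<close> and \<open>y\<^sub>j = z $ Inr j\<close>.\<close>

definition rogers_szego_prod ::
  "real \<Rightarrow> ('k \<Rightarrow> nat) \<Rightarrow> complex ^ ('k::finite + 'k) \<Rightarrow> complex" where
  "rogers_szego_prod q n z = (\<Prod>j\<in>UNIV. rogers_szego q (n j) (z $ Inl j) (z $ Inr j))"

definition stieltjes_wigert_prod ::
  "real \<Rightarrow> ('k \<Rightarrow> nat) \<Rightarrow> complex ^ ('k::finite + 'k) \<Rightarrow> complex" where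
  "stieltjes_wigert_prod q n z = (\<Prod>j\<in>UNIV. stieltjes_wigert q (n j) (z $ Inl j) (z $ Inr j))"

end

theory Submission
  imports Defs "HOL-Complex_Analysis.Cauchy_Integral_Formula"
begin

text \<open>
  Since \<open>g\<^sub>n(x, y|q) = h\<^sub>n(x, y|q\<^sup>-\<^sup>1)\<close>, both parts are instances of one statement about
  \<open>h\<^sub>n(x, y|p)\<close> for a real \<open>p > 0\<close> with \<open>p \<noteq> 1\<close>; all that matters about \<open>p\<close> is that
  \<open>1 - p\<^sup>k \<noteq> 0\<close> for \<open>k \<ge> 1\<close>.

  The p-derivatives involve a division by \<open>x\<^sub>j\<close> or \<open>y\<^sub>j\<close>, replaced by a limit where the variable
  vanishes. The proof works with the division-free equation
  \<open>y\<^sub>j (f - f[x\<^sub>j := p x\<^sub>j]) = x\<^sub>j (f - f[y\<^sub>j := p y\<^sub>j])\<close>, here called \<open>balanced\<close>. It is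
  equivalent to the differential equation off the coordinate hyperplanes and trivial on them.

  If \<open>f\<close> is expandable, the division-free equation follows term by term from the one for
  \<open>h\<^sub>n\<close> (\<open>rogers_szego_balanced\<close>), which is the recurrence of the q-binomial coefficients. To come
  back to the p-derivatives on the hyperplanes (\<open>p_partial_eq_if_balanced\<close>), continuity of \<open>f\<close>
  suffices where only one of \<open>x\<^sub>j, y\<^sub>j\<close> vanishes; where both vanish, the symmetry
  \<open>h\<^sub>n(x, y) = h\<^sub>n(y, x)\<close>, inherited by \<open>f\<close>, makes the two derivatives literally the same limit.

  Conversely, let \<open>f = \<Sum> c\<^sub>m z\<^sup>m\<close> solve the equations. Comparing coefficients in the division-free
  equation, by the identity theorem for multiple power series (\<open>multiple_powser_eq_0\<close>), gives
  a recurrence that trades a power of \<open>x\<^sub>j\<close> for a power of \<open>y\<^sub>j\<close>. It determines all \<open>c\<^sub>m\<close> from those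
  with no power of any \<open>x\<^sub>j\<close>: they are these values times products of q-binomial coefficients
  (\<open>coefficient_closed_form\<close>). Summing the absolutely convergent power series in finite blocks of
  fixed total degree in each pair \<open>x\<^sub>j, y\<^sub>j\<close> produces the expansion.
\<close>

section \<open>Polydiscs and monomials\<close>

text \<open>Polydiscs rather than balls serve as neighbourhoods of the origin, because the coordinates of
  a point can then be moved independently of each other.\<close>

definition polydisc :: "real \<Rightarrow> (complex ^ 'n::finite) set" where
  "polydisc r = {z. \<forall>i. norm (z $ i) < r}"

definition monomial :: "complex ^ 'n::finite \<Rightarrow> ('n \<Rightarrow> nat) \<Rightarrow> complex" where
  "monomial z m = (\<Prod>i\<in>UNIV. (z $ i) ^ m i)"

definition vec_upd :: "complex ^ 'n \<Rightarrow> 'n \<Rightarrow> complex \<Rightarrow> complex ^ 'n" where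
  "vec_upd z i t = (\<chi> l. if l = i then t else z $ l)"

lemma vec_upd_nth [simp]: "vec_upd z i t $ l = (if l = i then t else z $ l)"
  by (simp add: vec_upd_def)

lemma vec_upd_same [simp]: "vec_upd z i (z $ i) = z"
  by (simp add: vec_eq_iff)

lemma vec_upd_upd [simp]: "vec_upd (vec_upd z i s) i t = vec_upd z i t"
  by (simp add: vec_eq_iff)

lemma vec_upd_commute: "i \<noteq> j \<Longrightarrow> vec_upd (vec_upd z i s) j t = vec_upd (vec_upd z j t) i s"
  by (auto simp: vec_eq_iff)

lemma vec_upd_polydisc [intro]: "z \<in> polydisc r \<Longrightarrow> norm t < r \<Longrightarrow> vec_upd z i t \<in> polydisc r"
  by (auto simp: polydisc_def)

lemma polydisc_mono: "r \<le> s \<Longrightarrow> polydisc r \<subseteq> polydisc s"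
  by (auto simp: polydisc_def intro: less_le_trans)

lemma polydisc_nth: "z \<in> polydisc r \<Longrightarrow> norm (z $ i) < r"
  by (auto simp: polydisc_def)

text \<open>The radius is chosen so that a single bound covers \<open>p < 1\<close> and \<open>p > 1\<close> alike.\<close>

lemma scaled_radius:
  fixes a p R :: real
  assumes "p > 0" "a \<ge> 0" "a < R / (1 + p)"
  shows "a < R" "p * a < R"
proof -
  have "a + p * a < R"
    using assms by (simp add: field_simps)
  moreover have "0 \<le> p * a"
    using assms by simp
  ultimately show "a < R" "p * a < R"
    using assms(2) by linarith+
qed

lemma vec_upd_scale_polydisc:
  assumes "p > 0" "z \<in> polydisc (R / (1 + p))"
  shows "z \<in> polydisc R" "vec_upd z i (of_real p * z $ i) \<in> polydisc R"
  using scaled_radius[OF assms(1) norm_ge_zero polydisc_nth[OF assms(2)]] assms(1)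
  by (auto simp: polydisc_def norm_mult)

lemma eventually_nhds_0_polydisc:
  "(\<forall>\<^sub>F z in nhds (0 :: complex ^ 'n::finite). P z) \<longleftrightarrow> (\<exists>r>0. \<forall>z\<in>polydisc r. P z)"
proof
  assume "\<forall>\<^sub>F z in nhds (0 :: complex ^ 'n). P z"
  then obtain d where d: "d > 0" "\<And>z :: complex ^ 'n. norm z < d \<Longrightarrow> P z"
    by (auto simp: eventually_nhds_metric dist_norm)
  have "P z" if z: "z \<in> polydisc (d / CARD('n))" for z
  proof (rule d(2))
    have "norm z \<le> (\<Sum>i\<in>UNIV. norm (z $ i))"
      unfolding norm_vec_def by (rule L2_set_le_sum) simp
    also have "\<dots> < real CARD('n) * (d / CARD('n))"
      by (rule sum_bounded_above_strict) (use z in \<open>auto simp: polydisc_def\<close>)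
    finally show "norm z < d" by simp
  qed
  then show "\<exists>r>0. \<forall>z\<in>polydisc r. P z"
    using d(1) by (intro exI[of _ "d / CARD('n)"]) auto
next
  assume "\<exists>r>0. \<forall>z\<in>polydisc r. P z"
  then obtain r where r: "r > 0" "\<And>z. z \<in> polydisc r \<Longrightarrow> P z" by auto
  have "P z" if "norm z < r" for z
    by (rule r(2)) (auto simp: polydisc_def intro: le_less_trans[OF Finite_Cartesian_Product.norm_nth_le that])
  with r(1) show "\<forall>\<^sub>F z in nhds 0. P z"
    by (auto simp: eventually_nhds_metric dist_norm)
qed

lemma monomial_split: "monomial z m = z $ i ^ m i * (\<Prod>l\<in>UNIV - {i}. z $ l ^ m l)"
  unfolding monomial_def by (rule prod.remove) auto

lemma monomial_upd: "monomial (vec_upd z i t) m = t ^ m i * (\<Prod>l\<in>UNIV - {i}. z $ l ^ m l)"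
  by (subst monomial_split[of _ _ i]) (auto intro!: prod.cong)

lemma monomial_scale: "monomial (vec_upd z i (a * z $ i)) m = a ^ m i * monomial z m"
  by (simp add: monomial_upd monomial_split[of z m i] power_mult_distrib)

lemma monomial_fun_upd_Suc: "monomial z (m(i := Suc (m i))) = z $ i * monomial z m"
proof -
  have "(\<Prod>l\<in>UNIV - {i}. z $ l ^ (m(i := Suc (m i))) l) = (\<Prod>l\<in>UNIV - {i}. z $ l ^ m l)"
    by (rule prod.cong) auto
  then show ?thesis
    by (simp add: monomial_split[of z _ i])
qed

section \<open>Multiple power series\<close>

lemma has_sum_mult_variable:
  assumes "((\<lambda>m. c m * monomial z m) has_sum s) UNIV"
  shows "((\<lambda>m. (if m i = 0 then 0 else c (m(i := m i - 1))) * monomial z m) has_sum (z $ i * s)) UNIV"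
    (is "(?g has_sum _) UNIV")
proof -
  let ?h = "\<lambda>m :: 'a \<Rightarrow> nat. m(i := Suc (m i))"
  have "((\<lambda>m. z $ i * (c m * monomial z m)) has_sum (z $ i * s)) UNIV"
    by (rule has_sum_cmult_right[OF assms])
  also have "?this \<longleftrightarrow> (?g has_sum (z $ i * s)) {m. m i \<noteq> 0}"
    by (rule has_sum_reindex_bij_witness[of _ "\<lambda>m. m(i := m i - 1)" ?h])
       (auto simp: monomial_fun_upd_Suc)
  also have "\<dots> \<longleftrightarrow> (?g has_sum (z $ i * s)) UNIV"
    by (rule has_sum_cong_neutral) auto
  finally show ?thesis .
qed

lemma has_sum_powser_eq_0:
  fixes b :: "nat \<Rightarrow> complex"
  assumes r: "r > 0" and van: "\<And>t. norm t < r \<Longrightarrow> ((\<lambda>k. b k * t ^ k) has_sum 0) UNIV"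
  shows "b k = 0"
proof (rule ccontr)
  have sums: "(\<lambda>k. b k * t ^ k) sums 0" if "norm t < r" for t
    by (rule has_sum_imp_sums[OF van[OF that]])
  assume nz: "b k \<noteq> 0"
  have "b 0 = 0"
    using sums_unique2[OF sums[of 0] powser_sums_zero[of b]] r by simp
  with nz have "k > 0" by (cases k) auto
  with r sums nz
  obtain s where s: "s > 0" "\<And>z :: complex. z \<in> cball 0 s - {0} \<Longrightarrow> (0 :: complex) \<noteq> 0"
    using powser_0_nonzero[of r 0 b "\<lambda>_. 0" k] by (metis diff_zero)
  from s(2)[of "of_real s"] s(1) show False by simp
qed

text \<open>Moving one coordinate while the others stay fixed turns the multiple series into a power
  series in one variable. If it vanishes near the origin, then so does each of its coefficients,
  which are themselves the slices of the multiple series at a fixed exponent of that variable.\<close>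

lemma has_sum_0_slice:
  fixes d :: "('n::finite \<Rightarrow> nat) \<Rightarrow> complex"
  assumes r: "r > 0" and van: "\<And>z. z \<in> polydisc r \<Longrightarrow> ((\<lambda>m. d m * monomial z m) has_sum 0) A"
    and z: "z \<in> polydisc r"
  shows "((\<lambda>m. d m * monomial z m) has_sum 0) {m \<in> A. m i = K}"
proof -
  define w where "w m = d m * (\<Prod>l\<in>UNIV - {i}. z $ l ^ m l)" for m
  define S where "S k = {m \<in> A. m i = k}" for k
  have w_sum: "((\<lambda>m. w m * t ^ m i) has_sum 0) A" if "norm t < r" for t
    using van[OF vec_upd_polydisc[OF z that, of i]] by (simp add: monomial_upd w_def mult_ac)
  \<comment> \<open>Convergence at \<open>z\<close> itself gives nothing if \<open>z $ i = 0\<close>; any nonzero value of this coordinate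
    does, and \<open>r / 2\<close> is one within the polydisc.\<close>
  have summ: "w summable_on S k" for k
  proof -
    have "(\<lambda>m. w m * of_real (r / 2) ^ m i) summable_on S k"
      by (rule summable_on_subset_banach[OF has_sum_imp_summable[OF w_sum]])
         (use r in \<open>auto simp: S_def\<close>)
    also have "?this \<longleftrightarrow> (\<lambda>m. w m * of_real (r / 2) ^ k) summable_on S k"
      by (rule summable_on_cong) (auto simp: S_def)
    finally show ?thesis
      using r by (subst (asm) summable_on_cmult_left') auto
  qed
  have part: "((\<lambda>m. w m * t ^ m i) has_sum (infsum w (S k) * t ^ k)) (S k)" for t k
  proof -
    have "((\<lambda>m. w m * t ^ k) has_sum (infsum w (S k) * t ^ k)) (S k)"
      by (intro has_sum_cmult_left has_sum_infsum summ)
    also have "?this \<longleftrightarrow> ?thesis"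
      by (rule has_sum_cong) (auto simp: S_def)
    finally show ?thesis .
  qed
  have "((\<lambda>k. infsum w (S k) * t ^ k) has_sum 0) UNIV" if t: "norm t < r" for t
  proof (rule has_sum_SigmaD)
    have "((\<lambda>(k, m). w m * t ^ m i) has_sum 0) (Sigma UNIV S) \<longleftrightarrow> 
      ((\<lambda>m. w m * t ^ m i) has_sum 0) A"
      by (rule has_sum_reindex_bij_witness[of _ "\<lambda>m. (m i, m)" snd]) (auto simp: S_def)
    then show "((\<lambda>(k, m). w m * t ^ m i) has_sum 0) (Sigma UNIV S)"
      using w_sum[OF t] by simp
  qed (use part in auto)
  then have "infsum w (S K) = 0"
    by (rule has_sum_powser_eq_0[OF r])
  with part[of "z $ i" K] have "((\<lambda>m. w m * z $ i ^ m i) has_sum 0) (S K)" by simp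
  then show ?thesis
    by (simp add: S_def w_def monomial_split[of z _ i] mult_ac)
qed

text \<open>Slicing successively along all coordinates isolates a single term. Its monomial does not
  vanish at a point without zero coordinates, so its coefficient is zero.\<close>

lemma multiple_powser_eq_0:
  fixes d :: "('n::finite \<Rightarrow> nat) \<Rightarrow> complex"
  assumes r: "r > 0" and van: "\<And>z. z \<in> polydisc r \<Longrightarrow> ((\<lambda>m. d m * monomial z m) has_sum 0) UNIV"
  shows "d a = 0"
proof -
  have "((\<lambda>m. d m * monomial z m) has_sum 0) {m. \<forall>i\<in>I. m i = a i}"
    if "finite I" "z \<in> polydisc r" for I z
    using that
  proof (induction I arbitrary: z rule: finite_induct)
    case empty
    then show ?case using van by simp
  next
    case (insert i I)
    have "{m. \<forall>i\<in>insert i I. m i = a i} = {m \<in> {m. \<forall>i\<in>I. m i = a i}. m i = a i}" by auto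
    with has_sum_0_slice[OF r insert.IH insert.prems, of i "a i"] show ?case by simp
  qed
  from this[of UNIV "\<chi> i. of_real (r / 2)"] r
  have "((\<lambda>m. d m * monomial (\<chi> i. of_real (r / 2)) m) has_sum 0) {m. \<forall>i. m i = a i}"
    by (simp add: polydisc_def)
  moreover have "{m. \<forall>i. m i = a i} = {a}" by auto
  ultimately have "d a * monomial (\<chi> i. of_real (r / 2)) a = 0"
    by (simp add: has_sum_finite_iff)
  then show ?thesis
    using r by (simp add: monomial_def)
qed

text \<open>A multiple power series converges uniformly on a smaller polydisc, by comparison with its
  absolutely convergent value at a corner.\<close>

lemma continuous_on_multiple_powser:
  fixes c :: "('n::finite \<Rightarrow> nat) \<Rightarrow> complex"
  assumes r: "r > 0" and sums: "\<And>z. z \<in> polydisc r \<Longrightarrow> ((\<lambda>m. c m * monomial z m) has_sum f z) UNIV"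
  shows "continuous_on (polydisc (r / 2)) f"
proof (rule uniform_limit_theorem)
  let ?w = "\<chi> i. of_real (r / 2) :: complex ^ 'n"
  have "?w \<in> polydisc r" using r by (simp add: polydisc_def)
  from has_sum_imp_summable[OF sums[OF this]]
  have "(\<lambda>m. norm (c m * monomial ?w m)) summable_on UNIV"
    by (simp add: summable_on_iff_abs_summable_on_complex)
  moreover have "norm (c m * monomial z m) \<le> norm (c m * monomial ?w m)" if "z \<in> polydisc (r / 2)" for m z
    unfolding norm_mult monomial_def prod_norm[symmetric] norm_power
    by (intro mult_left_mono prod_mono conjI power_mono)
       (use that r in \<open>auto simp: polydisc_def intro: less_imp_le\<close>)
  ultimately show "uniform_limit (polydisc (r / 2)) (\<lambda>X z. \<Sum>m\<in>X. c m * monomial z m) f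
      (finite_subsets_at_top UNIV)"
    using r polydisc_mono[of "r / 2" r]
    by (intro Weierstrass_m_test_general'[where M = "\<lambda>m. norm (c m * monomial ?w m)"]) (auto intro: sums)
  show "\<forall>\<^sub>F X in finite_subsets_at_top UNIV.
      continuous_on (polydisc (r / 2)) (\<lambda>z. \<Sum>m\<in>X. c m * monomial z m)"
    unfolding monomial_def by (intro always_eventually allI continuous_intros)
qed (rule finite_subsets_at_top_neq_bot)

section \<open>q-binomial coefficients and Rogers-Szego polynomials\<close>

lemma one_minus_power_neq_0:
  assumes "0 < p" "p \<noteq> (1::real)"
  shows "1 - p ^ Suc k \<noteq> 0"
proof
  assume "1 - p ^ Suc k = 0"
  then have "p ^ Suc k = 1" by simp
  with assms show False
    by (metis less_eq_real_def power_eq_1_iff nat.distinct(1) abs_of_pos real_norm_def)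
qed

lemma q_pochhammer_Suc: "q_pochhammer p p (Suc n) = q_pochhammer p p n * (1 - p ^ Suc n)"
  by (simp add: q_pochhammer_def)

lemma q_pochhammer_neq_0:
  assumes "0 < p" "p \<noteq> 1"
  shows "q_pochhammer p p n \<noteq> 0"
proof (induction n)
  case (Suc n)
  then show ?case
    unfolding q_pochhammer_Suc using one_minus_power_neq_0[OF assms] by simp
qed (simp add: q_pochhammer_def)

lemma q_binomial_0:
  assumes "0 < p" "p \<noteq> 1"
  shows "q_binomial p n 0 = 1"
  using q_pochhammer_neq_0[OF assms, of n] by (simp add: q_binomial_def) (simp add: q_pochhammer_def)

lemma q_binomial_Suc:
  assumes "0 < p" "p \<noteq> 1"
  shows "q_binomial p (Suc (a + b)) (Suc a) * (1 - p ^ Suc a) =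
         q_binomial p (Suc (a + b)) a * (1 - p ^ Suc b)"
proof -
  have "Suc (a + b) - a = Suc b" by simp
  then show ?thesis
    using q_pochhammer_neq_0[OF assms] one_minus_power_neq_0[OF assms]
    unfolding q_binomial_def diff_Suc_Suc add_diff_cancel_left'
    by (simp add: q_pochhammer_Suc[of p a] q_pochhammer_Suc[of p b] del: power_Suc)
qed

lemma q_binomial_symmetric: "k \<le> n \<Longrightarrow> q_binomial p n (n - k) = q_binomial p n k"
  by (simp add: q_binomial_def mult.commute)

lemma rogers_szego_symmetric: "rogers_szego p n x y = rogers_szego p n y x"
  unfolding rogers_szego_def
  by (rule sum.reindex_bij_witness[of _ "\<lambda>k. n - k" "\<lambda>k. n - k"])
     (auto simp: q_binomial_symmetric)

text \<open>Up to normalisation, both the p-derivative in \<open>x\<close> and the one in \<open>y\<close> lower the index of a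
  Rogers-Szego polynomial by one. Multiplied by \<open>x * y\<close>, their equality needs no division.\<close>

lemma rogers_szego_balanced:
  assumes "0 < p" "p \<noteq> 1"
  shows "y * (rogers_szego p n x y - rogers_szego p n (of_real p * x) y) =
         x * (rogers_szego p n x y - rogers_szego p n x (of_real p * y))"
proof (cases n)
  case 0
  then show ?thesis by (simp add: rogers_szego_def)
next
  case (Suc m)
  let ?B = "\<lambda>k. complex_of_real (q_binomial p (Suc m) k)" and ?p = "complex_of_real p"
  have "y * (rogers_szego p (Suc m) x y - rogers_szego p (Suc m) (?p * x) y) =
        (\<Sum>k\<le>Suc m. y * (?B k * (1 - ?p ^ k) * x ^ k * y ^ (Suc m - k)))"
    unfolding rogers_szego_def sum_subtractf[symmetric] sum_distrib_left
    by (rule sum.cong) (simp_all add: power_mult_distrib algebra_simps)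
  also have "\<dots> = (\<Sum>k\<le>m. y * (?B (Suc k) * (1 - ?p ^ Suc k) * x ^ Suc k * y ^ (m - k)))"
    by (subst sum.atMost_Suc_shift) (simp del: power_Suc)
  also have "\<dots> = (\<Sum>k\<le>m. x * (?B k * (1 - ?p ^ (Suc m - k)) * x ^ k * y ^ (Suc m - k)))"
  proof (rule sum.cong[OF refl])
    fix k assume "k \<in> {..m}"
    then obtain l where m: "m = k + l" by (auto simp: le_iff_add)
    have rec: "?B (Suc k) * (1 - ?p ^ Suc k) = ?B k * (1 - ?p ^ (Suc m - k))"
    proof -
      have "Suc m - k = Suc l" by (simp add: m)
      moreover have "complex_of_real (q_binomial p (Suc m) (Suc k) * (1 - p ^ Suc k)) =
          complex_of_real (q_binomial p (Suc m) k * (1 - p ^ Suc l))"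
        unfolding m q_binomial_Suc[OF assms] ..
      ultimately show ?thesis by (simp del: power_Suc)
    qed
    have "y ^ (Suc m - k) = y * y ^ (m - k)" by (simp add: m Suc_diff_le)
    then show "y * (?B (Suc k) * (1 - ?p ^ Suc k) * x ^ Suc k * y ^ (m - k)) =
        x * (?B k * (1 - ?p ^ (Suc m - k)) * x ^ k * y ^ (Suc m - k))"
      unfolding rec by simp
  qed
  also have "\<dots> = (\<Sum>k\<le>Suc m. x * (?B k * (1 - ?p ^ (Suc m - k)) * x ^ k * y ^ (Suc m - k)))"
    by simp
  also have "\<dots> = x * (rogers_szego p (Suc m) x y - rogers_szego p (Suc m) x (?p * y))"
    unfolding rogers_szego_def sum_subtractf[symmetric] sum_distrib_left
    by (rule sum.cong) (simp_all add: power_mult_distrib algebra_simps)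
  finally show ?thesis using Suc by simp
qed

section \<open>The division-free form of the p-partial differential equation\<close>

definition balanced :: "real \<Rightarrow> 'n \<Rightarrow> 'n \<Rightarrow> (complex ^ 'n \<Rightarrow> complex) \<Rightarrow> complex ^ 'n \<Rightarrow> bool" where
  "balanced p i j f z \<longleftrightarrow>
     z $ j * (f z - f (vec_upd z i (of_real p * z $ i))) = z $ i * (f z - f (vec_upd z j (of_real p * z $ j)))"

definition interchange :: "'n \<Rightarrow> 'n \<Rightarrow> complex ^ 'n \<Rightarrow> complex ^ 'n" where
  "interchange i j z = vec_upd (vec_upd z i (z $ j)) j (z $ i)"

lemma p_partial_eq_quotient:
  "z $ i \<noteq> 0 \<Longrightarrow> p_partial p i f z = (f z - f (vec_upd z i (of_real p * z $ i))) / z $ i"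
  by (simp add: p_partial_def p_deriv_def vec_upd_def[symmetric])

lemma p_partial_at_0:
  "z $ i = 0 \<Longrightarrow>
     p_partial p i f z = Lim (at 0) (\<lambda>t. (f (vec_upd z i t) - f (vec_upd z i (of_real p * t))) / t)"
  by (simp add: p_partial_def p_deriv_def vec_upd_def[symmetric])

text \<open>Where \<open>z $ i = 0\<close> or \<open>z $ j = 0\<close>, both sides of the division-free equation vanish, so the
  values of the p-derivatives there are irrelevant.\<close>

lemma balanced_if_p_partial_eq:
  assumes "p_partial p i f z = p_partial p j f z"
  shows "balanced p i j f z"
proof -
  have "f (vec_upd z i 0) = f z" if "z $ i = 0" for i
    using vec_upd_same[of z i] that by simp
  then show ?thesis
    using assms
    by (cases "z $ i = 0"; cases "z $ j = 0")
       (simp_all add: balanced_def p_partial_eq_quotient field_simps)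
qed

lemma tendsto_vec_upd_0:
  assumes cont: "continuous_on (polydisc R) f" and z: "z \<in> polydisc R" "z $ i = 0" and R: "R > 0"
  shows "((\<lambda>t. f (vec_upd z i t)) \<longlongrightarrow> f z) (at 0)"
proof (rule continuous_on_tendsto_compose[OF cont _ z(1)])
  have "((\<lambda>t. vec_upd z i t) \<longlongrightarrow> vec_upd z i 0) (at 0)"
    unfolding vec_upd_def by (rule tendsto_vec_lambda) auto
  then show "((\<lambda>t. vec_upd z i t) \<longlongrightarrow> z) (at 0)"
    using vec_upd_same[of z i] z(2) by simp
  show "\<forall>\<^sub>F t in at 0. vec_upd z i t \<in> polydisc R"
    using z(1) R by (auto simp: eventually_at dist_norm intro!: exI[of _ R])
qed

text \<open>On the hyperplane \<open>z $ i = 0\<close> the division-free equation rewrites the difference quotient in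
  direction \<open>i\<close> as one in direction \<open>j\<close>, whose limit follows from continuity of \<open>f\<close> alone.\<close>

lemma p_partial_eq_if_balanced_at_0:
  assumes p: "p > 0" and R: "R > 0" and cont: "continuous_on (polydisc R) f"
    and bal: "\<And>z. z \<in> polydisc R \<Longrightarrow> balanced p i j f z" and ij: "i \<noteq> j"
    and z: "z \<in> polydisc (R / (1 + p))" "z $ i = 0" "z $ j \<noteq> 0"
  shows "p_partial p i f z = p_partial p j f z"
proof -
  define z' where "z' = vec_upd z j (of_real p * z $ j)"
  have zR: "z \<in> polydisc R" and z'R: "z' \<in> polydisc R"
    unfolding z'_def by (rule vec_upd_scale_polydisc[OF p z(1)])+
  have "((\<lambda>t. (f (vec_upd z i t) - f (vec_upd z' i t)) / z $ j) \<longlongrightarrow> (f z - f z') / z $ j) (at 0)"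
    using ij z(2,3) by (intro tendsto_intros tendsto_vec_upd_0[OF cont] zR z'R R) (auto simp: z'_def)
  moreover have "\<forall>\<^sub>F t in at 0. (f (vec_upd z i t) - f (vec_upd z' i t)) / z $ j =
      (f (vec_upd z i t) - f (vec_upd z i (of_real p * t))) / t"
    unfolding eventually_at
  proof (intro exI[of _ R] conjI ballI impI R)
    fix t :: complex assume t: "t \<noteq> 0 \<and> dist t 0 < R"
    then have "vec_upd z i t \<in> polydisc R" using zR by auto
    from bal[OF this] ij z(3) t
    show "(f (vec_upd z i t) - f (vec_upd z' i t)) / z $ j =
        (f (vec_upd z i t) - f (vec_upd z i (of_real p * t))) / t"
      by (simp add: balanced_def z'_def vec_upd_commute[OF ij] field_simps)
  qed
  ultimately have "((\<lambda>t. (f (vec_upd z i t) - f (vec_upd z i (of_real p * t))) / t) \<longlongrightarrow>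
      (f z - f z') / z $ j) (at 0)"
    by (rule Lim_transform_eventually)
  then have "p_partial p i f z = (f z - f z') / z $ j"
    unfolding p_partial_at_0[OF z(2)] by (intro tendsto_Lim) auto
  also have "\<dots> = p_partial p j f z"
    by (simp add: p_partial_eq_quotient[of z j] z(3) z'_def)
  finally show ?thesis .
qed

lemma balanced_commute: "balanced p i j f z \<longleftrightarrow> balanced p j i f z"
  unfolding balanced_def by (rule eq_commute)

text \<open>Where both variables vanish, the division-free equation carries no information at \<open>z\<close>, and
  symmetry of \<open>f\<close> in the two variables identifies the two difference quotients instead.\<close>

lemma p_partial_eq_if_balanced:
  assumes p: "p > 0" and R: "R > 0" and cont: "continuous_on (polydisc R) f"
    and bal: "\<And>z. z \<in> polydisc R \<Longrightarrow> balanced p i j f z" and ij: "i \<noteq> j"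
    and sym: "\<And>z. z \<in> polydisc R \<Longrightarrow> f (interchange i j z) = f z"
    and z: "z \<in> polydisc (R / (1 + p))"
  shows "p_partial p i f z = p_partial p j f z"
proof -
  have zR: "z \<in> polydisc R"
    by (rule vec_upd_scale_polydisc[OF p z])
  consider "z $ i = 0" "z $ j \<noteq> 0" | "z $ i \<noteq> 0" "z $ j = 0" | "z $ i \<noteq> 0" "z $ j \<noteq> 0"
    | "z $ i = 0" "z $ j = 0"
    by blast
  then show ?thesis
  proof cases
    case 1
    then show ?thesis
      using p_partial_eq_if_balanced_at_0[OF p R cont _ ij z] bal by metis
  next
    case 2
    then show ?thesis
      using p_partial_eq_if_balanced_at_0[OF p R cont _ not_sym[OF ij] z] bal balanced_commute by metis
  next
    case 3
    then show ?thesis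
      using bal[OF zR] by (simp add: p_partial_eq_quotient balanced_def field_simps)
  next
    case 4
    have swap: "f (vec_upd z j t) = f (vec_upd z i t)" if "norm t < R" for t
    proof -
      have "interchange i j (vec_upd z i t) = vec_upd z j t"
        using 4 ij by (auto simp: interchange_def vec_eq_iff)
      then show ?thesis using sym[OF vec_upd_polydisc[OF zR that, of i]] by simp
    qed
    have "\<forall>\<^sub>F t in at 0. (f (vec_upd z i t) - f (vec_upd z i (of_real p * t))) / t =
        (f (vec_upd z j t) - f (vec_upd z j (of_real p * t))) / t"
      unfolding eventually_at
    proof (intro exI[of _ "R / (1 + p)"] conjI ballI impI)
      fix t :: complex assume t: "t \<noteq> 0 \<and> dist t 0 < R / (1 + p)"
      then have "norm t < R" "norm (of_real p * t) < R"
        using scaled_radius[OF p norm_ge_zero, of t R] p by (auto simp: norm_mult)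
      then show "(f (vec_upd z i t) - f (vec_upd z i (of_real p * t))) / t =
          (f (vec_upd z j t) - f (vec_upd z j (of_real p * t))) / t"
        by (simp add: swap)
    qed (use p R in auto)
    then show ?thesis
      unfolding p_partial_at_0[OF 4(1)] p_partial_at_0[OF 4(2)] by (rule Lim_cong) simp
  qed
qed

section \<open>Expandable functions solve the equations\<close>

lemma rogers_szego_prod_split:
  "rogers_szego_prod p n z = rogers_szego p (n j) (z $ Inl j) (z $ Inr j) *
     (\<Prod>l\<in>UNIV - {j}. rogers_szego p (n l) (z $ Inl l) (z $ Inr l))"
  unfolding rogers_szego_prod_def by (rule prod.remove) auto

lemma rogers_szego_prod_balanced:
  assumes "0 < p" "p \<noteq> 1"
  shows "balanced p (Inl j) (Inr j) (rogers_szego_prod p n) z"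
proof -
  let ?P = "\<Prod>l\<in>UNIV - {j}. rogers_szego p (n l) (z $ Inl l) (z $ Inr l)"
  have P: "(\<Prod>l\<in>UNIV - {j}. rogers_szego p (n l) (vec_upd z s t $ Inl l) (vec_upd z s t $ Inr l)) = ?P"
    if "s = Inl j \<or> s = Inr j" for s t
    by (rule prod.cong) (use that in auto)
  have "z $ Inr j * (rogers_szego p (n j) (z $ Inl j) (z $ Inr j) -
          rogers_szego p (n j) (of_real p * z $ Inl j) (z $ Inr j)) * ?P =
        z $ Inl j * (rogers_szego p (n j) (z $ Inl j) (z $ Inr j) -
          rogers_szego p (n j) (z $ Inl j) (of_real p * z $ Inr j)) * ?P"
    by (simp only: rogers_szego_balanced[OF assms])
  then show ?thesis
    unfolding balanced_def rogers_szego_prod_split[of p n _ j]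
    by (simp add: P algebra_simps)
qed

lemma rogers_szego_prod_interchange:
  "rogers_szego_prod p n (interchange (Inl j) (Inr j) z) = rogers_szego_prod p n z"
  unfolding rogers_szego_prod_def
  by (rule prod.cong) (auto simp: interchange_def rogers_szego_symmetric)

lemma interchange_polydisc: "z \<in> polydisc R \<Longrightarrow> interchange i j z \<in> polydisc R"
  by (auto simp: interchange_def polydisc_def)

lemma has_sum_diff:
  fixes f g :: "'a \<Rightarrow> complex"
  assumes "(f has_sum a) A" "(g has_sum b) A"
  shows "((\<lambda>x. f x - g x) has_sum (a - b)) A"
  using has_sum_add[OF assms(1) has_sum_uminusI[OF assms(2)]] by simp

text \<open>The division-free equation is linear in the function, so it passes to convergent sums.\<close>

lemma balanced_has_sum:
  assumes "((\<lambda>n. \<alpha> n * \<phi> n z) has_sum f z) UNIV"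
    and "((\<lambda>n. \<alpha> n * \<phi> n (vec_upd z i (of_real p * z $ i))) has_sum f (vec_upd z i (of_real p * z $ i))) UNIV"
    and "((\<lambda>n. \<alpha> n * \<phi> n (vec_upd z j (of_real p * z $ j))) has_sum f (vec_upd z j (of_real p * z $ j))) UNIV"
    and bal: "\<And>n. balanced p i j (\<phi> n) z"
  shows "balanced p i j f z"
proof -
  have "z $ j * (\<alpha> n * \<phi> n z - \<alpha> n * \<phi> n (vec_upd z i (of_real p * z $ i))) =
        z $ i * (\<alpha> n * \<phi> n z - \<alpha> n * \<phi> n (vec_upd z j (of_real p * z $ j)))" for n
    using arg_cong[OF bal[of n, unfolded balanced_def], of "\<lambda>u. \<alpha> n * u"]
    by (simp add: algebra_simps)
  then show ?thesis
    unfolding balanced_def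
    using has_sum_unique[OF has_sum_cmult_right[OF has_sum_diff[OF assms(1,2)], of "z $ j"]]
      has_sum_cmult_right[OF has_sum_diff[OF assms(1,3)], of "z $ i"] by simp
qed

lemma p_partial_eq_if_expandable:
  fixes f :: "complex ^ ('k::finite + 'k) \<Rightarrow> complex"
  assumes p: "0 < p" "p \<noteq> 1" and f: "analytic_at_point f 0"
    and exp: "expandable_in f (rogers_szego_prod p)"
  shows "\<forall>\<^sub>F z in nhds 0. p_partial p (Inl j) f z = p_partial p (Inr j) f z"
proof -
  from f obtain c R1 where R1: "R1 > 0"
    and c: "\<And>z. z \<in> polydisc R1 \<Longrightarrow> ((\<lambda>m. c m * monomial z m) has_sum f z) UNIV"
    by (auto simp: analytic_at_point_def eventually_nhds_0_polydisc monomial_def)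
  from exp obtain \<alpha> R2 where R2: "R2 > 0"
    and \<alpha>: "\<And>z. z \<in> polydisc R2 \<Longrightarrow> ((\<lambda>n. \<alpha> n * rogers_szego_prod p n z) has_sum f z) UNIV"
    by (auto simp: expandable_in_def eventually_nhds_0_polydisc)
  \<comment> \<open>Halving \<open>R1\<close> gives continuity; dividing \<open>R2\<close> by \<open>1 + p\<close> keeps the rescaled points in the
    region of the expansion.\<close>
  define R where "R = min (R1 / 2) (R2 / (1 + p))"
  have R: "R > 0" using R1 R2 p by (auto simp: R_def)
  have sub: "polydisc R \<subseteq> (polydisc (R1 / 2) :: (complex ^ ('k + 'k)) set)"
            "polydisc R \<subseteq> (polydisc (R2 / (1 + p)) :: (complex ^ ('k + 'k)) set)"
    unfolding R_def by (rule polydisc_mono, rule min.cobounded1, rule polydisc_mono, rule min.cobounded2)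
  have "p_partial p (Inl j) f z = p_partial p (Inr j) f z" if z: "z \<in> polydisc (R / (1 + p))" for z
  proof (rule p_partial_eq_if_balanced[OF p(1) R _ _ _ _ z])
    show "continuous_on (polydisc R) f"
      by (rule continuous_on_subset[OF continuous_on_multiple_powser[OF R1 c] sub(1)])
    fix w :: "complex ^ ('k + 'k)" assume "w \<in> polydisc R"
    then have w: "w \<in> polydisc (R2 / (1 + p))" using sub by auto
    note wR = vec_upd_scale_polydisc[OF p(1) w]
    show "balanced p (Inl j) (Inr j) f w"
      by (rule balanced_has_sum[OF \<alpha>[OF wR(1)] \<alpha>[OF wR(2)] \<alpha>[OF wR(2)]])
         (rule rogers_szego_prod_balanced[OF p])
    show "f (interchange (Inl j) (Inr j) w) = f w"
      using \<alpha>[OF interchange_polydisc[OF wR(1), of "Inl j" "Inr j"]]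
      unfolding rogers_szego_prod_interchange by (rule has_sum_unique[OF _ \<alpha>[OF wR(1)]])
  qed auto
  then show ?thesis
    unfolding eventually_nhds_0_polydisc using R p by (intro exI[of _ "R / (1 + p)"]) auto
qed

section \<open>Solutions of the equations are expandable\<close>

text \<open>In the division-free equation both sides are multiple power series, so they can be compared
  coefficient by coefficient.\<close>

lemma coefficient_recurrence:
  fixes c :: "('n::finite \<Rightarrow> nat) \<Rightarrow> complex"
  assumes p: "0 < p" and R: "R > 0"
    and c: "\<And>z. z \<in> polydisc R \<Longrightarrow> ((\<lambda>m. c m * monomial z m) has_sum f z) UNIV"
    and bal: "\<And>z. z \<in> polydisc R \<Longrightarrow> balanced p i j f z" and ij: "i \<noteq> j"
  shows "c (m(i := Suc (m i))) * of_real (1 - p ^ Suc (m i)) =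
         c (m(j := Suc (m j))) * of_real (1 - p ^ Suc (m j))"
proof -
  define D where "D i m = c m * of_real (1 - p ^ m i)" for i m
  define S where "S i e m = (if m i = 0 then 0 else e (m(i := m i - 1)))"
    for i and e :: "('n \<Rightarrow> nat) \<Rightarrow> complex" and m :: "'n \<Rightarrow> nat"
  have D: "((\<lambda>m. D i m * monomial z m) has_sum (f z - f (vec_upd z i (of_real p * z $ i)))) UNIV"
    if "z \<in> polydisc (R / (1 + p))" for i z
    using has_sum_diff[OF c[OF vec_upd_scale_polydisc(1)[OF p that]] c[OF vec_upd_scale_polydisc(2)[OF p that]]]
    by (simp add: monomial_scale D_def algebra_simps)
  have "S j (D i) m' - S i (D j) m' = 0" for m'
  proof (rule multiple_powser_eq_0)
    show "R / (1 + p) > 0" using p R by simp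
    fix z :: "complex ^ 'n" assume z: "z \<in> polydisc (R / (1 + p))"
    show "((\<lambda>m. (S j (D i) m - S i (D j) m) * monomial z m) has_sum 0) UNIV"
      using has_sum_diff[OF has_sum_mult_variable[OF D[OF z, of i], of j]
          has_sum_mult_variable[OF D[OF z, of j], of i]]
        bal[OF vec_upd_scale_polydisc(1)[OF p z]]
      unfolding S_def balanced_def by (simp add: left_diff_distrib)
  qed
  \<comment> \<open>At this multi-index both exponents are positive, so neither shifted coefficient is the
    default \<open>0\<close>.\<close>
  from this[of "m(i := Suc (m i), j := Suc (m j))"] ij show ?thesis
    by (simp add: S_def D_def fun_upd_twist[OF ij] del: power_Suc)
       (simp add: fun_upd_twist[OF ij, symmetric] del: power_Suc)
qed

text \<open>The recurrence moves exponents from \<open>x\<^sub>j\<close> to \<open>y\<^sub>j\<close>, each move costing the ratio of two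
  consecutive q-binomial coefficients, until only powers of the \<open>y\<^sub>j\<close> are left.\<close>

lemma coefficient_closed_form:
  fixes c :: "('k::finite + 'k \<Rightarrow> nat) \<Rightarrow> complex"
  assumes p: "0 < p" "p \<noteq> 1"
    and rec: "\<And>j m. c (m(Inl j := Suc (m (Inl j)))) * of_real (1 - p ^ Suc (m (Inl j))) =
         c (m(Inr j := Suc (m (Inr j)))) * of_real (1 - p ^ Suc (m (Inr j)))"
  shows "c m = c (case_sum (\<lambda>_. 0) (\<lambda>j. m (Inl j) + m (Inr j))) *
               of_real (\<Prod>j\<in>UNIV. q_binomial p (m (Inl j) + m (Inr j)) (m (Inl j)))"
proof (induction "\<Sum>j\<in>UNIV. m (Inl j)" arbitrary: m)
  case 0
  then have 0: "m (Inl j) = 0" for j by simp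
  then have "case_sum (\<lambda>_. 0) (\<lambda>j. m (Inl j) + m (Inr j)) = m"
    by (auto simp: fun_eq_iff split: sum.splits)
  then show ?case by (simp only: 0 q_binomial_0[OF p]) simp
next
  case (Suc s)
  have "\<exists>j. m (Inl j) > 0"
    using Suc.hyps(2) by (metis neq0_conv sum.neutral nat.distinct(1))
  then obtain j a where a: "m (Inl j) = Suc a" by (auto simp: gr0_conv_Suc)
  define b where "b = m (Inr j)"
  define m' where "m' = m(Inl j := a, Inr j := Suc b)"
  have "(\<Sum>j\<in>UNIV. m (Inl j)) = Suc a + (\<Sum>l\<in>UNIV - {j}. m (Inl l))"
    by (subst sum.remove[of _ j]) (auto simp: a)
  moreover have "(\<Sum>j\<in>UNIV. m' (Inl j)) = a + (\<Sum>l\<in>UNIV - {j}. m (Inl l))"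
    by (subst sum.remove[of _ j]) (auto simp: m'_def intro!: sum.cong)
  ultimately have IH: "c m' = c (case_sum (\<lambda>_. 0) (\<lambda>j. m' (Inl j) + m' (Inr j))) *
      of_real (\<Prod>j\<in>UNIV. q_binomial p (m' (Inl j) + m' (Inr j)) (m' (Inl j)))"
    using Suc.hyps by simp
  have col: "(\<lambda>j. m' (Inl j) + m' (Inr j)) = (\<lambda>j. m (Inl j) + m (Inr j))"
    by (auto simp: m'_def a b_def)
  let ?C = "c (case_sum (\<lambda>_. 0) (\<lambda>j. m (Inl j) + m (Inr j)))"
  let ?P = "\<Prod>l\<in>UNIV - {j}. q_binomial p (m (Inl l) + m (Inr l)) (m (Inl l))"
  have prod_m': "(\<Prod>j\<in>UNIV. q_binomial p (m' (Inl j) + m' (Inr j)) (m' (Inl j))) =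
      q_binomial p (Suc (a + b)) a * ?P"
    by (subst prod.remove[of _ j]) (auto simp: m'_def intro!: prod.cong)
  have prod_m: "(\<Prod>j\<in>UNIV. q_binomial p (m (Inl j) + m (Inr j)) (m (Inl j))) =
      q_binomial p (Suc (a + b)) (Suc a) * ?P"
    by (subst prod.remove[of _ j]) (auto simp: a b_def)
  have "c m * of_real (1 - p ^ Suc a) = c m' * of_real (1 - p ^ Suc b)"
  proof -
    have "m(Inl j := Suc a) = m" by (simp add: a[symmetric])
    with rec[of "m(Inl j := a)" j] show ?thesis
      by (simp add: m'_def b_def del: power_Suc)
  qed
  then have "c m * of_real (1 - p ^ Suc a) =
      ?C * of_real (q_binomial p (Suc (a + b)) a * (1 - p ^ Suc b) * ?P)"
    using IH prod_m' by (simp add: col mult_ac del: power_Suc)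
  also have "\<dots> = ?C * of_real (q_binomial p (Suc (a + b)) (Suc a) * ?P) * of_real (1 - p ^ Suc a)"
    unfolding q_binomial_Suc[OF p, symmetric] by (simp add: mult_ac del: power_Suc)
  finally have "c m = ?C * of_real (q_binomial p (Suc (a + b)) (Suc a) * ?P)"
    using one_minus_power_neq_0[OF p, of a] by (simp del: power_Suc of_real_mult of_real_diff of_real_power)
  then show ?case by (simp only: prod_m)
qed

lemma prod_UNIV_sum:
  "(\<Prod>s\<in>UNIV. g s) = (\<Prod>j\<in>UNIV. g (Inl j) * g (Inr j :: 'a::finite + 'a))"
  using prod.Plus[of "UNIV :: 'a set" "UNIV :: 'a set" g] by (simp add: prod.distrib)

text \<open>For coefficients of the closed form, the terms of the power series with fixed total degrees
  \<open>n j\<close> in \<open>x\<^sub>j, y\<^sub>j\<close> multiply out to the \<open>n\<close>-th product of Rogers-Szego polynomials. Since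
  the series converges absolutely, it may be summed in these blocks.\<close>

lemma expandable_if_p_partial_eq:
  fixes f :: "complex ^ ('k::finite + 'k) \<Rightarrow> complex"
  assumes p: "0 < p" "p \<noteq> 1" and f: "analytic_at_point f 0"
    and pde: "\<And>j. \<forall>\<^sub>F z in nhds 0. p_partial p (Inl j) f z = p_partial p (Inr j) f z"
  shows "expandable_in f (rogers_szego_prod p)"
proof -
  have "\<forall>\<^sub>F z in nhds 0. \<forall>j. balanced p (Inl j) (Inr j) f z"
    by (intro eventually_all_finite eventually_mono[OF pde] balanced_if_p_partial_eq)
  moreover obtain c where "\<forall>\<^sub>F z in nhds 0. ((\<lambda>m. c m * monomial z m) has_sum f z) UNIV"
    using f by (auto simp: analytic_at_point_def monomial_def)
  ultimately have "\<forall>\<^sub>F z in nhds 0. (\<forall>j. balanced p (Inl j) (Inr j) f z) \<and>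
      ((\<lambda>m. c m * monomial z m) has_sum f z) UNIV"
    by (rule eventually_conj)
  then obtain R where R: "R > 0"
    and bal: "\<And>z j. z \<in> polydisc R \<Longrightarrow> balanced p (Inl j) (Inr j) f z"
    and c: "\<And>z. z \<in> polydisc R \<Longrightarrow> ((\<lambda>m. c m * monomial z m) has_sum f z) UNIV"
    unfolding eventually_nhds_0_polydisc by blast
  have rec: "c (m(Inl j := Suc (m (Inl j)))) * of_real (1 - p ^ Suc (m (Inl j))) =
         c (m(Inr j := Suc (m (Inr j)))) * of_real (1 - p ^ Suc (m (Inr j)))" for j m
    by (rule coefficient_recurrence[OF p(1) R c]) (use bal in auto)
  define \<alpha> where "\<alpha> n = c (case_sum (\<lambda>_. 0) n)" for n
  \<comment> \<open>\<open>Bx n\<close> lists the exponents of the \<open>x\<^sub>j\<close> in the block of total degrees \<open>n\<close>; \<open>ex n a\<close> is the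
    corresponding multi-index.\<close>
  define Bx where "Bx n = PiE UNIV (\<lambda>j :: 'k. {..n j :: nat})" for n
  define ex where "ex n a = case_sum a (\<lambda>j. n j - a j)" for n a :: "'k \<Rightarrow> nat"
  have le: "a j \<le> n j" if "a \<in> Bx n" for a n j
    using that by (auto simp: Bx_def PiE_def Pi_def)
  have block: "((\<lambda>a. c (ex n a) * monomial z (ex n a)) has_sum (\<alpha> n * rogers_szego_prod p n z)) (Bx n)" for n z
  proof (rule has_sum_finiteI)
    show "finite (Bx n)" unfolding Bx_def by (rule finite_PiE) auto
    have "\<alpha> n * rogers_szego_prod p n z = (\<Sum>a\<in>Bx n. \<alpha> n * (\<Prod>j\<in>UNIV.
        of_real (q_binomial p (n j) (a j)) * z $ Inl j ^ a j * z $ Inr j ^ (n j - a j)))"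
      unfolding rogers_szego_prod_def rogers_szego_def Bx_def
      by (subst prod_sum_PiE) (auto simp: sum_distrib_left)
    also have "\<dots> = (\<Sum>a\<in>Bx n. c (ex n a) * monomial z (ex n a))"
    proof (rule sum.cong[OF refl])
      fix a assume "a \<in> Bx n"
      then have "(\<lambda>j. a j + (n j - a j)) = n" using le by (auto simp: fun_eq_iff)
      moreover from this have "a j + (n j - a j) = n j" for j by metis
      ultimately have "c (ex n a) = \<alpha> n * of_real (\<Prod>j\<in>UNIV. q_binomial p (n j) (a j))"
        using coefficient_closed_form[of p c "ex n a", OF p rec] by (simp add: \<alpha>_def ex_def)
      moreover have "monomial z (ex n a) = (\<Prod>j\<in>UNIV. z $ Inl j ^ a j * z $ Inr j ^ (n j - a j))"
        by (simp add: monomial_def prod_UNIV_sum ex_def)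
      ultimately show "\<alpha> n * (\<Prod>j\<in>UNIV.
          of_real (q_binomial p (n j) (a j)) * z $ Inl j ^ a j * z $ Inr j ^ (n j - a j)) =
          c (ex n a) * monomial z (ex n a)"
        by (simp add: prod.distrib mult_ac)
    qed
    finally show "\<alpha> n * rogers_szego_prod p n z = (\<Sum>a\<in>Bx n. c (ex n a) * monomial z (ex n a))" .
  qed
  have "((\<lambda>n. \<alpha> n * rogers_szego_prod p n z) has_sum f z) UNIV" if z: "z \<in> polydisc R" for z
  proof (rule has_sum_SigmaD)
    have "((\<lambda>(n, a). c (ex n a) * monomial z (ex n a)) has_sum f z) (Sigma UNIV Bx) \<longleftrightarrow>
        ((\<lambda>m. c m * monomial z m) has_sum f z) UNIV"
    proof (rule has_sum_reindex_bij_witness[of _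
          "\<lambda>m. (\<lambda>j. m (Inl j) + m (Inr j), \<lambda>j. m (Inl j))" "\<lambda>(n, a). ex n a"])
    qed (auto simp: ex_def Bx_def fun_eq_iff PiE_def Pi_def split: sum.splits)
    then show "((\<lambda>(n, a). c (ex n a) * monomial z (ex n a)) has_sum f z) (Sigma UNIV Bx)"
      using c[OF z] by simp
  qed (use block in auto)
  then show ?thesis
    unfolding expandable_in_def eventually_nhds_0_polydisc
    using R by (auto intro!: exI[of _ \<alpha>] exI[of _ R]
      simp: summable_on_iff_abs_summable_on_complex[symmetric] intro: has_sum_imp_summable)
qed

section \<open>The expansion theorem\<close>

theorem theorem1p7:
  fixes q :: real and f :: "complex ^ ('k::finite + 'k) \<Rightarrow> complex"
  assumes "0 < q" and "q < 1"
    and "analytic_at_point f 0"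
  shows "(expandable_in f (rogers_szego_prod q) \<longleftrightarrow>
            (\<forall>j::'k. \<forall>\<^sub>F z in nhds 0. p_partial q (Inl j) f z = p_partial q (Inr j) f z)) \<and>
         (expandable_in f (stieltjes_wigert_prod q) \<longleftrightarrow>
            (\<forall>j::'k. \<forall>\<^sub>F z in nhds 0.
               p_partial (inverse q) (Inl j) f z = p_partial (inverse q) (Inr j) f z))"
proof -
  have main: "expandable_in f (rogers_szego_prod p) \<longleftrightarrow>
      (\<forall>j::'k. \<forall>\<^sub>F z in nhds 0. p_partial p (Inl j) f z = p_partial p (Inr j) f z)"
    if "0 < p" "p \<noteq> 1" for p
    using p_partial_eq_if_expandable[OF that assms(3)] expandable_if_p_partial_eq[OF that assms(3)]
    by blast
  have "(stieltjes_wigert_prod q :: ('k \<Rightarrow> nat) \<Rightarrow> _) = rogers_szego_prod (inverse q)"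
    using assms(1) by (simp add: fun_eq_iff stieltjes_wigert_prod_def rogers_szego_prod_def
        stieltjes_wigert_conv_rogers_szego)
  moreover have "0 < inverse q" "inverse q \<noteq> 1"
    using assms(1,2) by auto
  ultimately show ?thesis
    using main[of q] main[of "inverse q"] assms(1,2) by simp
qed

end
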